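(* For each $\psi\in\Psi$ let $Q(\cdot\,|\,\psi)$ be a probability measure on $\Psi^{-1}\{\psi\}$ absolutely continuous with respect to $\nu_{\Psi^{-1}\{\psi\}}$, and let $\psi_0\in\Psi$. The Gâteaux derivative of $RB_\Psi(\cdot\,|\,x)$ at $\psi_0$ in the direction $Q$ (perturbing the conditional prior of $\theta$ given $\psi$), i.e. $\lim_{\epsilon\to0}\{RB_{\epsilon,\Psi}(\psi_0\,|\,x)-RB_\Psi(\psi_0\,|\,x)\}/\epsilon$, is $$\frac{m_Q(x)}{m(x)}\big(RB_{Q,\Psi}(\psi_0\,|\,x)-RB_\Psi(\psi_0\,|\,x)\big).$$
   Context: Setting. $\{f_\theta:\theta\in\Theta\}$ is a statistical model of probability densities with respect to volume measure $\mu$ on a sample space $\mathcal X$ (volume measure on a discrete set is counting measure); $x$ is the observed data. $\Pi$ is a proper prior on $\Theta$ with density $\pi$ with respect to volume measure $\nu$. $\Psi:\Theta\to\Psi$ is an onto map (same symbol for map and range), $\psi=\Psi(\theta)$, $\Pi_\Psi$ is the marginal prior of $\psi$ with density $\pi_\Psi$ with respect to a support measure $\nu_\Psi$ on $\Psi$, and $\Pi(\cdot\,|\,\psi)$ is the conditional prior of $\theta$ given $\Psi(\theta)=\psi$, having a density with respect to volume measure $\nu_{\Psi^{-1}\{\psi\}}$ on $\Psi^{-1}\{\psi\}$. The conditional prior predictive density is $m(x\,|\,\psi)=\int_{\Psi^{-1}\{\psi\}}f_\theta(x)\,\Pi(d\theta\,|\,\psi)$ and the prior predictive density is $m(x)=\int_\Psi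 m(x\,|\,\psi)\,\Pi_\Psi(d\psi)$, with $m(x)>0$. The relative belief ratio is $RB_\Psi(\psi\,|\,x)=\pi_\Psi(\psi\,|\,x)/\pi_\Psi(\psi)=m(x\,|\,\psi)/m(x)$, where $\pi_\Psi(\cdot\,|\,x)$ is the posterior density of $\psi$. Perturbed prior: $\Pi_\epsilon=[(1-\epsilon)\Pi(\cdot\,|\,\psi)+\epsilon Q(\cdot\,|\,\psi)]\times\Pi_\Psi$, i.e. the marginal prior of $\psi$ is $\Pi_\Psi$ (unchanged) and the conditional prior of $\theta$ given $\psi$ is $(1-\epsilon)\Pi(\cdot\,|\,\psi)+\epsilon Q(\cdot\,|\,\psi)$. Put $m_Q(x\,|\,\psi)=\int_{\Psi^{-1}\{\psi\}}f_\theta(x)\,Q(d\theta\,|\,\psi)$, $m_Q(x)=\int_\Psi m_Q(x\,|\,\psi)\,\Pi_\Psi(d\psi)$ and $RB_{Q,\Psi}(\psi\,|\,x)=m_Q(x\,|\,\psi)/m_Q(x)$. The relative belief ratio for $\psi$ based on $\Pi_\epsilon$ is $RB_{\epsilon,\Psi}(\psi\,|\,x)=(1-\epsilon_x)RB_\Psi(\psi\,|\,x)+\epsilon_xRB_{Q,\Psi}(\psi\,|\,x)$ with $\epsilon_x=\epsilon m_Q(x)/[(1-\epsilon)m(x)+\epsilon m_Q(x)]$. *)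

theory Defs
  imports "HOL-Probability.Probability"
begin

text \<open>
  A proper prior on the parameter space is given by its marginal \<open>M\<close> for \<open>\<psi> = \<Psi> \<theta>\<close> together with
  a conditional prior \<open>K \<psi>\<close> of \<open>\<theta>\<close> given \<open>\<psi>\<close>; the prior itself is the mixture \<open>M \<bind> K\<close>.
  Each \<open>K \<psi>\<close> is a measure on the whole parameter space that is concentrated on the fibre
  \<open>\<Psi> \<theta> = \<psi>\<close>, so that an integral against \<open>K \<psi>\<close> is an integral over that fibre.  The model
  densities are written \<open>f \<theta> x\<close>.
\<close>

definition cond_pred ::
    "('t \<Rightarrow> 'x \<Rightarrow> real) \<Rightarrow> ('p \<Rightarrow> 't measure) \<Rightarrow> 'x \<Rightarrow> 'p \<Rightarrow> real"
  where "cond_pred f K x \<psi> = (\<integral>\<theta>. f \<theta> x \<partial>K \<psi>)"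

definition prior_pred ::
    "('t \<Rightarrow> 'x \<Rightarrow> real) \<Rightarrow> ('p \<Rightarrow> 't measure) \<Rightarrow> 'p measure \<Rightarrow> 'x \<Rightarrow> real"
  where "prior_pred f K M x = (\<integral>\<psi>. cond_pred f K x \<psi> \<partial>M)"

text \<open>
  The ratio of posterior to prior density of \<open>\<psi>\<close>, in the version \<open>m(x | \<psi>) / m(x)\<close>, which is
  specified at every \<open>\<psi>\<close> and not just almost everywhere; see \<open>posterior_marginal\<close> and
  \<open>posterior_marginal_density\<close> below.
\<close>
definition rel_belief ::
    "('t \<Rightarrow> 'x \<Rightarrow> real) \<Rightarrow> ('p \<Rightarrow> 't measure) \<Rightarrow> 'p measure \<Rightarrow> 'x \<Rightarrow> 'p \<Rightarrow> real"
  where "rel_belief f K M x \<psi> = cond_pred f K x \<psi> / prior_pred f K M x"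

text \<open>
  The mixture \<open>(1 - \<epsilon>) M + \<epsilon> N\<close> of two measures on the same measurable space; it has this meaning
  only for \<open>0 \<le> \<epsilon> \<le> 1\<close>, since \<open>ennreal\<close> truncates negative weights to \<open>0\<close>.
\<close>
definition mix_measure :: "real \<Rightarrow> 'a measure \<Rightarrow> 'a measure \<Rightarrow> 'a measure"
  where "mix_measure \<epsilon> M N = measure_of (space M) (sets M)
    (\<lambda>A. ennreal (1 - \<epsilon>) * emeasure M A + ennreal \<epsilon> * emeasure N A)"

definition perturbed_cond ::
    "real \<Rightarrow> ('p \<Rightarrow> 't measure) \<Rightarrow> ('p \<Rightarrow> 't measure) \<Rightarrow> 'p \<Rightarrow> 't measure"
  where "perturbed_cond \<epsilon> K Q \<psi> = mix_measure \<epsilon> (K \<psi>) (Q \<psi>)"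

text \<open>
  For \<open>0 \<le> \<epsilon> \<le> 1\<close> the relative belief ratio of the perturbed prior is the average of the two relative
  belief ratios with weight \<open>perturbed_weight m mQ \<epsilon>\<close> on the second one, where \<open>m\<close> and \<open>mQ\<close> are
  the prior predictive densities.  The average also makes sense for small negative \<open>\<epsilon>\<close>, where
  there is no perturbed prior.
\<close>
definition perturbed_weight :: "real \<Rightarrow> real \<Rightarrow> real \<Rightarrow> real"
  where "perturbed_weight m mQ \<epsilon> = \<epsilon> * mQ / ((1 - \<epsilon>) * m + \<epsilon> * mQ)"

definition posterior ::
    "('t \<Rightarrow> 'x \<Rightarrow> real) \<Rightarrow> ('p \<Rightarrow> 't measure) \<Rightarrow> 'p measure \<Rightarrow> 'x \<Rightarrow> 't measure"
  where "posterior f K M x = density (M \<bind> K) (\<lambda>\<theta>. ennreal (f \<theta> x / prior_pred f K M x))"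

text \<open>
  The reference (volume) measures \<open>\<mu>\<close>, \<open>\<nu>\<close>, \<open>\<nu>\<Psi>\<close> and \<open>\<nu>fib \<psi>\<close> are arbitrary.  Here \<open>\<nu>fib \<psi>\<close> stands
  for the volume measure of the fibre over \<open>\<psi>\<close>, regarded as a measure on the whole parameter
  space that vanishes off that fibre.
\<close>
locale rb_model =
  fixes \<mu> :: "'x measure"
    and f :: "'t \<Rightarrow> 'x \<Rightarrow> real"
    and \<nu> :: "'t measure"
    and P :: "'t measure" and p :: "'t \<Rightarrow> real"
    and \<Psi> :: "'t \<Rightarrow> 'p"
    and \<nu>\<Psi> :: "'p measure"
    and P\<Psi> :: "'p measure" and p\<Psi> :: "'p \<Rightarrow> real"
    and \<nu>fib :: "'p \<Rightarrow> 't measure"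
    and K :: "'p \<Rightarrow> 't measure" and k :: "'p \<Rightarrow> 't \<Rightarrow> real"
  assumes model_measurable: "\<theta> \<in> space \<nu> \<Longrightarrow> f \<theta> \<in> borel_measurable \<mu>"
    and model_nonneg: "\<theta> \<in> space \<nu> \<Longrightarrow> y \<in> space \<mu> \<Longrightarrow> 0 \<le> f \<theta> y"
    and model_density: "\<theta> \<in> space \<nu> \<Longrightarrow> (\<integral>\<^sup>+ y. ennreal (f \<theta> y) \<partial>\<mu>) = 1"
    and likelihood_measurable: "y \<in> space \<mu> \<Longrightarrow> (\<lambda>\<theta>. f \<theta> y) \<in> borel_measurable \<nu>"
    and prior_density_measurable: "p \<in> borel_measurable \<nu>"
    and prior_density_nonneg: "\<theta> \<in> space \<nu> \<Longrightarrow> 0 \<le> p \<theta>"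
    and prior_density: "P = density \<nu> (\<lambda>\<theta>. ennreal (p \<theta>))"
    and prior_prob: "prob_space P"
    and Psi_measurable: "\<Psi> \<in> measurable \<nu> \<nu>\<Psi>"
    and Psi_onto: "\<Psi> ` space \<nu> = space \<nu>\<Psi>"
    and marginal: "P\<Psi> = distr P \<nu>\<Psi> \<Psi>"
    and marginal_density_measurable: "p\<Psi> \<in> borel_measurable \<nu>\<Psi>"
    and marginal_density_nonneg: "\<psi> \<in> space \<nu>\<Psi> \<Longrightarrow> 0 \<le> p\<Psi> \<psi>"
    and marginal_density: "P\<Psi> = density \<nu>\<Psi> (\<lambda>\<psi>. ennreal (p\<Psi> \<psi>))"
    and fibre_sets: "\<psi> \<in> space \<nu>\<Psi> \<Longrightarrow> sets (\<nu>fib \<psi>) = sets \<nu>"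
    and fibre_concentrated: "\<psi> \<in> space \<nu>\<Psi> \<Longrightarrow> AE \<theta> in \<nu>fib \<psi>. \<Psi> \<theta> = \<psi>"
    and cond_density_measurable: "\<psi> \<in> space \<nu>\<Psi> \<Longrightarrow> k \<psi> \<in> borel_measurable \<nu>"
    and cond_density_nonneg: "\<psi> \<in> space \<nu>\<Psi> \<Longrightarrow> \<theta> \<in> space \<nu> \<Longrightarrow> 0 \<le> k \<psi> \<theta>"
    and cond_density: "\<psi> \<in> space \<nu>\<Psi> \<Longrightarrow> K \<psi> = density (\<nu>fib \<psi>) (\<lambda>\<theta>. ennreal (k \<psi> \<theta>))"
    and cond_kernel: "K \<in> measurable \<nu>\<Psi> (prob_algebra \<nu>)"
    and disintegration: "P = P\<Psi> \<bind> K"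

text \<open>
  Bayes' rule: the posterior of \<open>\<psi>\<close> has density \<open>rel_belief\<close> with respect to its prior.
\<close>
lemma posterior_marginal:
  fixes f :: "'t \<Rightarrow> 'x \<Rightarrow> real"
  assumes K: "K \<in> measurable M (prob_algebra N)" and \<Psi>: "\<Psi> \<in> measurable N M"
    and conc: "\<And>\<psi>. \<psi> \<in> space M \<Longrightarrow> AE \<theta> in K \<psi>. \<Psi> \<theta> = \<psi>"
    and ne: "space M \<noteq> {}"
    and f: "(\<lambda>\<theta>. f \<theta> x) \<in> borel_measurable N"
    and nonneg: "\<And>\<theta>. \<theta> \<in> space N \<Longrightarrow> 0 \<le> f \<theta> x"
    and int: "integrable (M \<bind> K) (\<lambda>\<theta>. f \<theta> x)"
    and pos: "0 < prior_pred f K M x"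
  shows "distr (posterior f K M x) M \<Psi> = density M (\<lambda>\<psi>. ennreal (rel_belief f K M x \<psi>))"
proof (rule measure_eqI)
  fix A assume "A \<in> sets (distr (posterior f K M x) M \<Psi>)"
  then have A[measurable]: "A \<in> sets M" by simp
  note f[measurable] \<Psi>[measurable]
  have K'[measurable]: "K \<in> measurable M (subprob_algebra N)"
    using K by (rule measurable_prob_algebraD)
  define c where "c = prior_pred f K M x"
  have c: "0 < c" using pos by (simp add: c_def)
  have sK: "sets (K \<psi>) = sets N" if "\<psi> \<in> space M" for \<psi>
    using K' that by (rule sets_kernel)
  have sB: "sets (M \<bind> K) = sets N" using sK ne by (rule sets_bind)
  have spB: "space (M \<bind> K) = space N" using sB by (rule sets_eq_imp_space_eq)
  have spK: "space (K \<psi>) = space N" if "\<psi> \<in> space M" for \<psi>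
    using sK[OF that] by (rule sets_eq_imp_space_eq)
  have "(\<integral>\<^sup>+ \<psi>. (\<integral>\<^sup>+ \<theta>. ennreal (f \<theta> x) \<partial>K \<psi>) \<partial>M) = (\<integral>\<^sup>+ \<theta>. ennreal (f \<theta> x) \<partial>(M \<bind> K))"
    by (rule nn_integral_bind[symmetric, where B=N]) measurable
  also have "\<dots> = (\<integral>\<^sup>+ \<theta>. ennreal (norm (f \<theta> x)) \<partial>(M \<bind> K))"
    by (intro nn_integral_cong) (simp add: spB nonneg)
  also have "\<dots> < \<infinity>" using int unfolding integrable_iff_bounded by blast
  finally have "AE \<psi> in M. (\<integral>\<^sup>+ \<theta>. ennreal (f \<theta> x) \<partial>K \<psi>) \<noteq> \<infinity>"
    by (intro nn_integral_noteq_infinite) auto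
  then have ae: "AE \<psi> in M. (\<integral>\<^sup>+ \<theta>. ennreal (f \<theta> x) \<partial>K \<psi>) = ennreal (cond_pred f K x \<psi>)"
    using AE_space
  proof eventually_elim
    case (elim \<psi>)
    have "(\<lambda>\<theta>. f \<theta> x) \<in> borel_measurable (K \<psi>)"
      using f by (simp add: measurable_cong_sets[OF sK[OF elim(2)] refl])
    then have "integrable (K \<psi>) (\<lambda>\<theta>. f \<theta> x)"
      using elim nonneg by (intro integrableI_nonneg AE_I2) (auto simp: spK top.not_eq_extremum)
    then show ?case
      unfolding cond_pred_def
      by (intro nn_integral_eq_integral AE_I2) (simp_all add: spK elim nonneg)
  qed
  have mc[measurable]: "cond_pred f K x \<in> borel_measurable M"
    unfolding cond_pred_def by measurable
  have split: "ennreal (f \<theta> x / c) = ennreal (1 / c) * ennreal (f \<theta> x)" if "\<theta> \<in> space N" for \<theta>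
    using c nonneg[OF that] by (simp add: ennreal_mult[symmetric])
  have "emeasure (distr (posterior f K M x) M \<Psi>) A
      = emeasure (posterior f K M x) (\<Psi> -` A \<inter> space N)"
    by (subst emeasure_distr) (simp_all add: posterior_def spB measurable_cong_sets[OF sB refl])
  also have "\<dots> = (\<integral>\<^sup>+ \<theta>. ennreal (f \<theta> x / c) * indicator (\<Psi> -` A \<inter> space N) \<theta> \<partial>(M \<bind> K))"
    unfolding posterior_def c_def[symmetric]
    by (rule emeasure_density) (simp_all add: measurable_cong_sets[OF sB refl] sB)
  also have "\<dots> = (\<integral>\<^sup>+ \<psi>. (\<integral>\<^sup>+ \<theta>. ennreal (f \<theta> x / c) * indicator (\<Psi> -` A \<inter> space N) \<theta> \<partial>K \<psi>) \<partial>M)"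
    by (rule nn_integral_bind[where B=N]) measurable
  also have "\<dots> = (\<integral>\<^sup>+ \<psi>. ennreal (rel_belief f K M x \<psi>) * indicator A \<psi> \<partial>M)"
  proof (rule nn_integral_cong_AE)
    show "AE \<psi> in M. (\<integral>\<^sup>+ \<theta>. ennreal (f \<theta> x / c) * indicator (\<Psi> -` A \<inter> space N) \<theta> \<partial>K \<psi>)
        = ennreal (rel_belief f K M x \<psi>) * indicator A \<psi>"
      using ae AE_space
    proof eventually_elim
      case (elim \<psi>)
      have "(\<integral>\<^sup>+ \<theta>. ennreal (f \<theta> x / c) * indicator (\<Psi> -` A \<inter> space N) \<theta> \<partial>K \<psi>)
          = (\<integral>\<^sup>+ \<theta>. (ennreal (1 / c) * indicator A \<psi>) * ennreal (f \<theta> x) \<partial>K \<psi>)"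
      proof (rule nn_integral_cong_AE)
        show "AE \<theta> in K \<psi>. ennreal (f \<theta> x / c) * indicator (\<Psi> -` A \<inter> space N) \<theta>
            = (ennreal (1 / c) * indicator A \<psi>) * ennreal (f \<theta> x)"
          using conc[OF elim(2)] AE_space
          by eventually_elim (auto simp: spK elim split indicator_def)
      qed
      also have "\<dots> = (ennreal (1 / c) * indicator A \<psi>) * (\<integral>\<^sup>+ \<theta>. ennreal (f \<theta> x) \<partial>K \<psi>)"
        by (rule nn_integral_cmult) (use f in \<open>simp add: measurable_cong_sets[OF sK[OF elim(2)] refl]\<close>)
      also have "\<dots> = (ennreal (1 / c) * ennreal (cond_pred f K x \<psi>)) * indicator A \<psi>"
        by (simp add: elim mult_ac)
      also have "ennreal (1 / c) * ennreal (cond_pred f K x \<psi>) = ennreal (rel_belief f K M x \<psi>)"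
        using c by (simp add: rel_belief_def c_def[symmetric] ennreal_mult'[symmetric])
      finally show ?case .
    qed
  qed
  also have "\<dots> = emeasure (density M (\<lambda>\<psi>. ennreal (rel_belief f K M x \<psi>))) A"
    unfolding rel_belief_def by (rule emeasure_density[symmetric]) measurable
  finally show "emeasure (distr (posterior f K M x) M \<Psi>) A
      = emeasure (density M (\<lambda>\<psi>. ennreal (rel_belief f K M x \<psi>))) A" .
qed (simp add: posterior_def)

text \<open>
  Hence, when the prior of \<open>\<psi>\<close> has density \<open>p\<Psi>\<close>, a posterior density of \<open>\<psi>\<close> is \<open>p\<Psi>\<close> times \<open>rel_belief\<close>,
  so that \<open>rel_belief\<close> is the ratio of the two densities.
\<close>
corollary posterior_marginal_density:
  fixes f :: "'t \<Rightarrow> 'x \<Rightarrow> real" and p\<Psi> :: "'p \<Rightarrow> real"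
  assumes M: "M = density \<nu>\<Psi> (\<lambda>\<psi>. ennreal (p\<Psi> \<psi>))"
    and p\<Psi>: "p\<Psi> \<in> borel_measurable \<nu>\<Psi>" "\<And>\<psi>. \<psi> \<in> space \<nu>\<Psi> \<Longrightarrow> 0 \<le> p\<Psi> \<psi>"
    and K: "K \<in> measurable M (prob_algebra N)" and \<Psi>: "\<Psi> \<in> measurable N M"
    and conc: "\<And>\<psi>. \<psi> \<in> space M \<Longrightarrow> AE \<theta> in K \<psi>. \<Psi> \<theta> = \<psi>"
    and ne: "space M \<noteq> {}"
    and f: "(\<lambda>\<theta>. f \<theta> x) \<in> borel_measurable N"
    and nonneg: "\<And>\<theta>. \<theta> \<in> space N \<Longrightarrow> 0 \<le> f \<theta> x"
    and int: "integrable (M \<bind> K) (\<lambda>\<theta>. f \<theta> x)"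
    and pos: "0 < prior_pred f K M x"
  shows "distr (posterior f K M x) M \<Psi> = density \<nu>\<Psi> (\<lambda>\<psi>. ennreal (p\<Psi> \<psi> * rel_belief f K M x \<psi>))"
proof -
  note f[measurable] p\<Psi>(1)[measurable]
  have [measurable]: "K \<in> measurable \<nu>\<Psi> (subprob_algebra N)"
    using measurable_prob_algebraD[OF K] by (simp add: M)
  have [measurable]: "rel_belief f K M x \<in> borel_measurable \<nu>\<Psi>"
    unfolding rel_belief_def cond_pred_def by measurable
  have "density M (\<lambda>\<psi>. ennreal (rel_belief f K M x \<psi>))
      = density (density \<nu>\<Psi> (\<lambda>\<psi>. ennreal (p\<Psi> \<psi>))) (\<lambda>\<psi>. ennreal (rel_belief f K M x \<psi>))"
    by (subst M) simp
  also have "\<dots> = density \<nu>\<Psi> (\<lambda>\<psi>. ennreal (p\<Psi> \<psi>) * ennreal (rel_belief f K M x \<psi>))"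
    by (rule density_density_eq) measurable
  also have "\<dots> = density \<nu>\<Psi> (\<lambda>\<psi>. ennreal (p\<Psi> \<psi> * rel_belief f K M x \<psi>))"
    by (rule density_cong) (auto simp: p\<Psi>(2) ennreal_mult')
  finally show ?thesis
    using posterior_marginal[OF K \<Psi> conc ne f nonneg int pos] by simp
qed

end

theory Submission
  imports Defs
begin

text \<open>
  Integration is linear in the measure, so perturbing the conditional prior and then averaging over
  the unchanged marginal prior acts linearly on both levels: for \<open>0 \<le> \<epsilon> \<le> 1\<close>,
  \<open>m\<^sub>\<epsilon>(x | \<psi>) = (1 - \<epsilon>) m(x | \<psi>) + \<epsilon> m\<^sub>Q(x | \<psi>)\<close> (\<open>cond_pred_perturbed\<close>) and
  \<open>m\<^sub>\<epsilon>(x) = (1 - \<epsilon>) m(x) + \<epsilon> m\<^sub>Q(x)\<close> (\<open>prior_pred_perturbed\<close>).  The quotient of these two affine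
  functions of \<open>\<epsilon>\<close> is the average of the two relative belief ratios with weight
  \<open>\<epsilon>\<^sub>x = \<epsilon> m\<^sub>Q(x) / m\<^sub>\<epsilon>(x)\<close> on the second (\<open>rel_belief_perturbed\<close>).  Hence the difference quotient is
  exactly \<open>(\<epsilon>\<^sub>x / \<epsilon>) (RB\<^sub>Q - RB)\<close>, and \<open>\<epsilon>\<^sub>x / \<epsilon> = m\<^sub>Q(x) / m\<^sub>\<epsilon>(x)\<close> tends to \<open>m\<^sub>Q(x) / m(x)\<close>
  (\<open>tendsto_weight_quotient\<close>).

  The work is in the second affine identity.  Away from \<open>\<psi>\<^sub>0\<close> the likelihood is assumed integrable
  only over the whole parameter space, so that the first identity is available merely for almost
  every \<open>\<psi>\<close>, by Fubini's theorem for kernels (\<open>integrable_bind_kernel\<close>).  To integrate it one also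
  needs both sides to be measurable in \<open>\<psi>\<close>; for the left side this holds because the perturbed
  conditional prior is again a kernel (\<open>measurable_perturbed_cond\<close>).

  The average with weight \<open>\<epsilon>\<^sub>x\<close> is a smooth function of \<open>\<epsilon>\<close> near \<open>0\<close>, which gives the two-sided
  limit; it is the relative belief ratio of a prior for \<open>0 \<le> \<epsilon> \<le> 1\<close>, which gives the one-sided limit.
\<close>

section \<open>Integration against a mixture of two measures\<close>

lemma sets_mix_measure [simp]: "sets (mix_measure \<epsilon> M N) = sets M"
  by (simp add: mix_measure_def)

lemma emeasure_mix_measure:
  assumes "sets N = sets M" "A \<in> sets M"
  shows "emeasure (mix_measure \<epsilon> M N) A
    = ennreal (1 - \<epsilon>) * emeasure M A + ennreal \<epsilon> * emeasure N A"
  unfolding mix_measure_def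
proof (rule emeasure_measure_of_sigma)
  show "countably_additive (sets M) (\<lambda>A. ennreal (1 - \<epsilon>) * emeasure M A + ennreal \<epsilon> * emeasure N A)"
  proof (rule countably_additiveI)
    fix B :: "nat \<Rightarrow> 'a set"
    assume "range B \<subseteq> sets M" "disjoint_family B" "\<Union> (range B) \<in> sets M"
    then show "(\<Sum>i. ennreal (1 - \<epsilon>) * emeasure M (B i) + ennreal \<epsilon> * emeasure N (B i))
        = ennreal (1 - \<epsilon>) * emeasure M (\<Union> (range B)) + ennreal \<epsilon> * emeasure N (\<Union> (range B))"
      using assms(1) by (simp add: suminf_add[symmetric] suminf_emeasure)
  qed
qed (use assms in \<open>auto simp: positive_def sets.sigma_algebra_axioms\<close>)

lemma nn_integral_mix_measure:
  assumes sets: "sets N = sets M" and g: "g \<in> borel_measurable M"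
  shows "(\<integral>\<^sup>+ \<theta>. g \<theta> \<partial>mix_measure \<epsilon> M N)
    = ennreal (1 - \<epsilon>) * (\<integral>\<^sup>+ \<theta>. g \<theta> \<partial>M) + ennreal \<epsilon> * (\<integral>\<^sup>+ \<theta>. g \<theta> \<partial>N)"
  using g
proof (induction rule: borel_measurable_induct)
  case (cong h h')
  have "(\<integral>\<^sup>+ \<theta>. h \<theta> \<partial>L) = (\<integral>\<^sup>+ \<theta>. h' \<theta> \<partial>L)" if "sets L = sets M" for L
    using cong(3) sets_eq_imp_space_eq[OF that] by (intro nn_integral_cong) simp
  then show ?case using cong(4) sets by simp
next
  case (set A)
  then show ?case by (simp add: sets emeasure_mix_measure)
next
  case (mult h c)
  have "(\<integral>\<^sup>+ \<theta>. c * h \<theta> \<partial>L) = c * (\<integral>\<^sup>+ \<theta>. h \<theta> \<partial>L)" if "sets L = sets M" for L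
    using mult.hyps by (intro nn_integral_cmult) (simp add: measurable_cong_sets[OF that refl])
  then show ?case by (simp add: mult.IH sets distrib_left mult.left_commute[of c])
next
  case (add h h')
  have "(\<integral>\<^sup>+ \<theta>. h \<theta> + h' \<theta> \<partial>L) = (\<integral>\<^sup>+ \<theta>. h \<theta> \<partial>L) + (\<integral>\<^sup>+ \<theta>. h' \<theta> \<partial>L)" if "sets L = sets M" for L
    using add.hyps by (intro nn_integral_add) (simp_all add: measurable_cong_sets[OF that refl])
  then show ?case by (simp add: add.IH sets distrib_left add_ac)
next
  case (seq U)
  have mono: "incseq (\<lambda>i. \<integral>\<^sup>+ \<theta>. U i \<theta> \<partial>L)" for L
    using seq.hyps by (auto intro!: incseq_SucI nn_integral_mono simp: incseq_Suc_iff le_fun_def)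
  have conv: "(\<integral>\<^sup>+ \<theta>. (SUP i. U i) \<theta> \<partial>L) = (SUP i. \<integral>\<^sup>+ \<theta>. U i \<theta> \<partial>L)"
    if "sets L = sets M" for L
    using seq.hyps
    by (simp add: image_comp nn_integral_monotone_convergence_SUP measurable_cong_sets[OF that refl])
  have "(\<integral>\<^sup>+ \<theta>. (SUP i. U i) \<theta> \<partial>mix_measure \<epsilon> M N)
      = (SUP i. ennreal (1 - \<epsilon>) * (\<integral>\<^sup>+ \<theta>. U i \<theta> \<partial>M) + ennreal \<epsilon> * (\<integral>\<^sup>+ \<theta>. U i \<theta> \<partial>N))"
    unfolding conv[OF sets_mix_measure] by (simp only: seq.IH)
  also have "\<dots> = (SUP i. ennreal (1 - \<epsilon>) * (\<integral>\<^sup>+ \<theta>. U i \<theta> \<partial>M)) + (SUP i. ennreal \<epsilon> * (\<integral>\<^sup>+ \<theta>. U i \<theta> \<partial>N))"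
    using mono by (intro ennreal_SUP_add) (auto simp: incseq_def intro!: mult_left_mono)
  also have "\<dots> = ennreal (1 - \<epsilon>) * (\<integral>\<^sup>+ \<theta>. (SUP i. U i) \<theta> \<partial>M) + ennreal \<epsilon> * (\<integral>\<^sup>+ \<theta>. (SUP i. U i) \<theta> \<partial>N)"
    unfolding conv[OF sets] conv[OF refl] by (simp only: SUP_mult_left_ennreal)
  finally show ?case .
qed

lemma integral_mix_measure:
  fixes g :: "'a \<Rightarrow> real"
  assumes sets: "sets N = sets M" and \<epsilon>: "0 \<le> \<epsilon>" "\<epsilon> \<le> 1"
    and int: "integrable M g" "integrable N g"
  shows "(\<integral>\<theta>. g \<theta> \<partial>mix_measure \<epsilon> M N) = (1 - \<epsilon>) * (\<integral>\<theta>. g \<theta> \<partial>M) + \<epsilon> * (\<integral>\<theta>. g \<theta> \<partial>N)"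
proof -
  have meas: "g \<in> borel_measurable M" using int(1) by blast
  \<comment> \<open>The positive and the negative part of \<open>g\<close> have finite integrals, so each can be mixed in \<open>ennreal\<close>.\<close>
  have mix: "(\<integral>\<^sup>+ \<theta>. ennreal (h \<theta>) \<partial>mix_measure \<epsilon> M N)
      = ennreal ((1 - \<epsilon>) * enn2real (\<integral>\<^sup>+ \<theta>. ennreal (h \<theta>) \<partial>M) + \<epsilon> * enn2real (\<integral>\<^sup>+ \<theta>. ennreal (h \<theta>) \<partial>N))"
    if "integrable M h" "integrable N h" for h :: "'a \<Rightarrow> real"
  proof -
    have "(\<integral>\<^sup>+ \<theta>. ennreal (h \<theta>) \<partial>L) = ennreal (enn2real (\<integral>\<^sup>+ \<theta>. ennreal (h \<theta>) \<partial>L))"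
      if "integrable L h" for L
      using that unfolding real_integrable_def by (simp add: top.not_eq_extremum)
    from this[OF that(1)] this[OF that(2)] show ?thesis
      using that(1) \<epsilon> by (simp add: nn_integral_mix_measure[OF sets] ennreal_plus ennreal_mult)
  qed
  note pos = mix[OF int] and neg = mix[OF int[THEN Bochner_Integration.integrable_minus]]
  have "integrable (mix_measure \<epsilon> M N) g"
    unfolding real_integrable_def pos neg
    using meas by (simp add: measurable_cong_sets[OF sets_mix_measure refl])
  then have "(\<integral>\<theta>. g \<theta> \<partial>mix_measure \<epsilon> M N)
      = ((1 - \<epsilon>) * enn2real (\<integral>\<^sup>+ \<theta>. ennreal (g \<theta>) \<partial>M) + \<epsilon> * enn2real (\<integral>\<^sup>+ \<theta>. ennreal (g \<theta>) \<partial>N))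
        - ((1 - \<epsilon>) * enn2real (\<integral>\<^sup>+ \<theta>. ennreal (- g \<theta>) \<partial>M) + \<epsilon> * enn2real (\<integral>\<^sup>+ \<theta>. ennreal (- g \<theta>) \<partial>N))"
    using \<epsilon> by (simp only: real_lebesgue_integral_def pos neg) (simp flip: ennreal_plus)
  then show ?thesis
    by (simp only: real_lebesgue_integral_def int) (simp only: algebra_simps)
qed

section \<open>Kernels\<close>

text \<open>
  Fubini's theorem for the composition of a measure with a kernel: finiteness of the iterated
  integral of \<open>\<bar>g\<bar>\<close> makes the inner integral finite almost everywhere, and dominates
  the inner integral of \<open>g\<close>.
\<close>
lemma integrable_bind_kernel:
  fixes g :: "'t \<Rightarrow> real"
  assumes K: "K \<in> measurable M (subprob_algebra N)"
    and g: "g \<in> borel_measurable N" and int: "integrable (M \<bind> K) g"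
  shows "AE \<psi> in M. integrable (K \<psi>) g"
    and "integrable M (\<lambda>\<psi>. \<integral>\<theta>. g \<theta> \<partial>K \<psi>)"
proof -
  note K[measurable] g[measurable]
  have "(\<integral>\<^sup>+ \<psi>. (\<integral>\<^sup>+ \<theta>. ennreal (norm (g \<theta>)) \<partial>K \<psi>) \<partial>M)
      = (\<integral>\<^sup>+ \<theta>. ennreal (norm (g \<theta>)) \<partial>(M \<bind> K))"
    by (rule nn_integral_bind[symmetric, where B=N]) measurable
  also have "\<dots> < \<infinity>" using int unfolding integrable_iff_bounded by blast
  finally have fin: "(\<integral>\<^sup>+ \<psi>. (\<integral>\<^sup>+ \<theta>. ennreal (norm (g \<theta>)) \<partial>K \<psi>) \<partial>M) < \<infinity>" .
  then have "AE \<psi> in M. (\<integral>\<^sup>+ \<theta>. ennreal (norm (g \<theta>)) \<partial>K \<psi>) \<noteq> \<infinity>"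
    by (intro nn_integral_noteq_infinite) auto
  then show ae: "AE \<psi> in M. integrable (K \<psi>) g"
    using AE_space
    by eventually_elim (use g in \<open>auto simp: integrable_iff_bounded top.not_eq_extremum
        measurable_cong_sets[OF sets_kernel[OF K] refl]\<close>)
  have "(\<integral>\<^sup>+ \<psi>. ennreal (norm (\<integral>\<theta>. g \<theta> \<partial>K \<psi>)) \<partial>M)
      \<le> (\<integral>\<^sup>+ \<psi>. (\<integral>\<^sup>+ \<theta>. ennreal (norm (g \<theta>)) \<partial>K \<psi>) \<partial>M)"
    using ae by (intro nn_integral_mono_AE) (elim eventually_mono, rule integral_norm_bound_ennreal)
  also note fin
  finally show "integrable M (\<lambda>\<psi>. \<integral>\<theta>. g \<theta> \<partial>K \<psi>)"
    by (intro integrableI_bounded) measurable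
qed

lemma measurable_perturbed_cond:
  assumes K: "K \<in> measurable M (prob_algebra N)" and Q: "Q \<in> measurable M (prob_algebra N)"
    and \<epsilon>: "0 \<le> \<epsilon>" "\<epsilon> \<le> 1"
  shows "perturbed_cond \<epsilon> K Q \<in> measurable M (subprob_algebra N)"
proof (rule measurable_subprob_algebra)
  note K' = measurable_prob_algebraD[OF K] and Q' = measurable_prob_algebraD[OF Q]
  note K'[measurable] Q'[measurable]
  have sets: "sets (K \<psi>) = sets N" "sets (Q \<psi>) = sets N" if "\<psi> \<in> space M" for \<psi>
    using sets_kernel[OF K' that] sets_kernel[OF Q' that] by simp_all
  have em: "emeasure (perturbed_cond \<epsilon> K Q \<psi>) A
      = ennreal (1 - \<epsilon>) * emeasure (K \<psi>) A + ennreal \<epsilon> * emeasure (Q \<psi>) A"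
    if "\<psi> \<in> space M" "A \<in> sets N" for \<psi> A
    using that by (simp add: perturbed_cond_def emeasure_mix_measure sets)
  show "sets (perturbed_cond \<epsilon> K Q \<psi>) = sets N" if "\<psi> \<in> space M" for \<psi>
    using that by (simp add: perturbed_cond_def sets)
  show "(\<lambda>\<psi>. emeasure (perturbed_cond \<epsilon> K Q \<psi>) A) \<in> borel_measurable M" if [measurable]: "A \<in> sets N" for A
    by (subst measurable_cong[OF em]) (use that in measurable)
  show "subprob_space (perturbed_cond \<epsilon> K Q \<psi>)" if \<psi>: "\<psi> \<in> space M" for \<psi>
  proof (rule prob_space_imp_subprob_space, rule prob_spaceI)
    have "prob_space (K \<psi>)" "prob_space (Q \<psi>)"
      using measurable_space[OF K \<psi>] measurable_space[OF Q \<psi>] by (auto simp: space_prob_algebra)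
    moreover have "space (K \<psi>) = space N" "space (Q \<psi>) = space N"
      "space (perturbed_cond \<epsilon> K Q \<psi>) = space N"
      using sets[OF \<psi>] by (auto intro!: sets_eq_imp_space_eq simp: perturbed_cond_def)
    ultimately show "emeasure (perturbed_cond \<epsilon> K Q \<psi>) (space (perturbed_cond \<epsilon> K Q \<psi>)) = 1"
      using \<epsilon> em[OF \<psi> sets.top] prob_space.emeasure_space_1[of "K \<psi>"] prob_space.emeasure_space_1[of "Q \<psi>"]
      by (simp flip: ennreal_plus)
  qed
qed

section \<open>Predictive densities and relative belief under perturbation\<close>

lemma cond_pred_perturbed:
  assumes "sets (Q \<psi>) = sets (K \<psi>)" "0 \<le> \<epsilon>" "\<epsilon> \<le> 1"
    and "integrable (K \<psi>) (\<lambda>\<theta>. f \<theta> x)" "integrable (Q \<psi>) (\<lambda>\<theta>. f \<theta> x)"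
  shows "cond_pred f (perturbed_cond \<epsilon> K Q) x \<psi>
    = (1 - \<epsilon>) * cond_pred f K x \<psi> + \<epsilon> * cond_pred f Q x \<psi>"
  unfolding cond_pred_def perturbed_cond_def using assms by (rule integral_mix_measure)

lemma prior_pred_perturbed:
  assumes K: "K \<in> measurable M (prob_algebra N)" and Q: "Q \<in> measurable M (prob_algebra N)"
    and \<epsilon>: "0 \<le> \<epsilon>" "\<epsilon> \<le> 1"
    and f: "(\<lambda>\<theta>. f \<theta> x) \<in> borel_measurable N"
    and int: "integrable (M \<bind> K) (\<lambda>\<theta>. f \<theta> x)" "integrable (M \<bind> Q) (\<lambda>\<theta>. f \<theta> x)"
  shows "prior_pred f (perturbed_cond \<epsilon> K Q) M x
    = (1 - \<epsilon>) * prior_pred f K M x + \<epsilon> * prior_pred f Q M x"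
proof -
  note K' = measurable_prob_algebraD[OF K] and Q' = measurable_prob_algebraD[OF Q]
  note f[measurable] K'[measurable] Q'[measurable] measurable_perturbed_cond[OF K Q \<epsilon>, measurable]
  have meas [measurable]: "cond_pred f L x \<in> borel_measurable M"
    if [measurable]: "L \<in> measurable M (subprob_algebra N)" for L
    unfolding cond_pred_def by measurable
  have "prior_pred f (perturbed_cond \<epsilon> K Q) M x
      = (\<integral>\<psi>. (1 - \<epsilon>) * cond_pred f K x \<psi> + \<epsilon> * cond_pred f Q x \<psi> \<partial>M)"
    unfolding prior_pred_def
  proof (rule integral_cong_AE)
    show "AE \<psi> in M. cond_pred f (perturbed_cond \<epsilon> K Q) x \<psi>
        = (1 - \<epsilon>) * cond_pred f K x \<psi> + \<epsilon> * cond_pred f Q x \<psi>"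
      using integrable_bind_kernel(1)[OF K' f int(1)] integrable_bind_kernel(1)[OF Q' f int(2)] AE_space
      by eventually_elim (simp add: cond_pred_perturbed \<epsilon> sets_kernel[OF K'] sets_kernel[OF Q'])
  qed measurable
  also have "\<dots> = (1 - \<epsilon>) * prior_pred f K M x + \<epsilon> * prior_pred f Q M x"
    using integrable_bind_kernel(2)[OF K' f int(1)] integrable_bind_kernel(2)[OF Q' f int(2)]
    by (simp add: prior_pred_def cond_pred_def)
  finally show ?thesis .
qed

text \<open>
  The weights arise by multiplying and dividing each numerator term by its own normalising constant:
  \<open>\<epsilon> m\<^sub>Q(x | \<psi>) / m\<^sub>\<epsilon>(x) = (\<epsilon> m\<^sub>Q(x) / m\<^sub>\<epsilon>(x)) (m\<^sub>Q(x | \<psi>) / m\<^sub>Q(x))\<close>, which is why both prior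
  predictive densities have to be nonzero.
\<close>
lemma rel_belief_perturbed:
  assumes K: "K \<in> measurable M (prob_algebra N)" and Q: "Q \<in> measurable M (prob_algebra N)"
    and \<epsilon>: "0 \<le> \<epsilon>" "\<epsilon> \<le> 1" and \<psi>: "\<psi> \<in> space M"
    and f: "(\<lambda>\<theta>. f \<theta> x) \<in> borel_measurable N"
    and int: "integrable (M \<bind> K) (\<lambda>\<theta>. f \<theta> x)" "integrable (M \<bind> Q) (\<lambda>\<theta>. f \<theta> x)"
    and int\<psi>: "integrable (K \<psi>) (\<lambda>\<theta>. f \<theta> x)" "integrable (Q \<psi>) (\<lambda>\<theta>. f \<theta> x)"
    and pos: "0 < prior_pred f K M x" "0 < prior_pred f Q M x"
  defines "w \<equiv> perturbed_weight (prior_pred f K M x) (prior_pred f Q M x) \<epsilon>"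
  shows "rel_belief f (perturbed_cond \<epsilon> K Q) M x \<psi>
    = (1 - w) * rel_belief f K M x \<psi> + w * rel_belief f Q M x \<psi>"
proof -
  define m mQ D where "m = prior_pred f K M x" and "mQ = prior_pred f Q M x"
    and "D = (1 - \<epsilon>) * m + \<epsilon> * mQ"
  have "sets (Q \<psi>) = sets (K \<psi>)"
    using \<psi> by (simp add: sets_kernel[OF measurable_prob_algebraD[OF K]]
        sets_kernel[OF measurable_prob_algebraD[OF Q]])
  then have RB: "rel_belief f (perturbed_cond \<epsilon> K Q) M x \<psi>
      = ((1 - \<epsilon>) * cond_pred f K x \<psi> + \<epsilon> * cond_pred f Q x \<psi>) / D"
    by (simp add: rel_belief_def D_def m_def mQ_def
        prior_pred_perturbed[where f=f and x=x, OF K Q \<epsilon> f int] cond_pred_perturbed \<epsilon> int\<psi>)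
  have mpos: "0 < m" "0 < mQ" using pos by (simp_all add: m_def mQ_def)
  have "0 < D"
  proof (cases "\<epsilon> = 0")
    case False
    then show ?thesis using \<epsilon> mpos by (simp add: D_def add_nonneg_pos)
  qed (use mpos in \<open>simp add: D_def\<close>)
  have w: "w = \<epsilon> * mQ / D"
    by (simp add: w_def perturbed_weight_def D_def m_def mQ_def)
  moreover have "1 - w = (1 - \<epsilon>) * m / D"
    using \<open>0 < D\<close> unfolding w by (simp add: eq_divide_eq left_diff_distrib) (simp add: D_def left_diff_distrib)
  ultimately show ?thesis
    unfolding RB using mpos by (simp add: rel_belief_def m_def[symmetric] mQ_def[symmetric] add_divide_distrib)
qed

text \<open>
  Since \<open>(1 - w) r + w r\<^sub>Q - r = w (r\<^sub>Q - r)\<close>, the limit is that of \<open>w \<epsilon> / \<epsilon>\<close>, in which the factor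
  \<open>\<epsilon>\<close> cancels and leaves a function continuous at \<open>0\<close>.
\<close>
lemma tendsto_weight_quotient:
  fixes m mQ r rQ :: real
  assumes m: "m \<noteq> 0"
  defines "w \<equiv> perturbed_weight m mQ"
  shows "((\<lambda>\<epsilon>. ((1 - w \<epsilon>) * r + w \<epsilon> * rQ - r) / \<epsilon>) \<longlongrightarrow> mQ / m * (rQ - r)) (at 0)"
proof -
  have "((\<lambda>\<epsilon>. mQ / ((1 - \<epsilon>) * m + \<epsilon> * mQ) * (rQ - r)) \<longlongrightarrow> mQ / ((1 - 0) * m + 0 * mQ) * (rQ - r)) (at 0)"
    using m by (intro tendsto_intros) auto
  moreover have "((1 - w \<epsilon>) * r + w \<epsilon> * rQ - r) / \<epsilon> = mQ / ((1 - \<epsilon>) * m + \<epsilon> * mQ) * (rQ - r)"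
    if "\<epsilon> \<noteq> 0" for \<epsilon>
  proof -
    have "(1 - w \<epsilon>) * r + w \<epsilon> * rQ - r = w \<epsilon> * (rQ - r)" by (simp add: algebra_simps)
    then show ?thesis using that by (simp add: w_def perturbed_weight_def)
  qed
  then have "\<forall>\<^sub>F \<epsilon> in at 0. mQ / ((1 - \<epsilon>) * m + \<epsilon> * mQ) * (rQ - r) = ((1 - w \<epsilon>) * r + w \<epsilon> * rQ - r) / \<epsilon>"
    by (simp add: eventually_at_filter)
  ultimately show ?thesis by (simp add: Lim_transform_eventually)
qed

theorem proposition6:
  fixes \<mu> :: "'x measure"
    and f :: "'t \<Rightarrow> 'x \<Rightarrow> real"
    and \<nu> P :: "'t measure" and p :: "'t \<Rightarrow> real"
    and \<Psi> :: "'t \<Rightarrow> 'p"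
    and \<nu>\<Psi> P\<Psi> :: "'p measure" and p\<Psi> :: "'p \<Rightarrow> real"
    and \<nu>fib K Q :: "'p \<Rightarrow> 't measure" and k :: "'p \<Rightarrow> 't \<Rightarrow> real"
    and x :: 'x and \<psi>0 :: 'p
  assumes model: "rb_model \<mu> f \<nu> P p \<Psi> \<nu>\<Psi> P\<Psi> p\<Psi> \<nu>fib K k"
    and Q_kernel: "Q \<in> measurable \<nu>\<Psi> (prob_algebra \<nu>)"
    and Q_fibre: "\<And>\<psi>. \<psi> \<in> space \<nu>\<Psi> \<Longrightarrow> AE \<theta> in Q \<psi>. \<Psi> \<theta> = \<psi>"
    and Q_ac: "\<And>\<psi>. \<psi> \<in> space \<nu>\<Psi> \<Longrightarrow> absolutely_continuous (\<nu>fib \<psi>) (Q \<psi>)"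
    and x: "x \<in> space \<mu>"
    and \<psi>0: "\<psi>0 \<in> space \<nu>\<Psi>"
    and m_finite: "integrable P (\<lambda>\<theta>. f \<theta> x)" "integrable (K \<psi>0) (\<lambda>\<theta>. f \<theta> x)"
    and mQ_finite: "integrable (P\<Psi> \<bind> Q) (\<lambda>\<theta>. f \<theta> x)" "integrable (Q \<psi>0) (\<lambda>\<theta>. f \<theta> x)"
    and m_pos: "0 < prior_pred f K P\<Psi> x"
    and mQ_pos: "0 < prior_pred f Q P\<Psi> x"
  defines "m \<equiv> prior_pred f K P\<Psi> x"
    and "mQ \<equiv> prior_pred f Q P\<Psi> x"
    and "RB \<equiv> rel_belief f K P\<Psi> x"
    and "RBQ \<equiv> rel_belief f Q P\<Psi> x"
    and "RB\<epsilon> \<equiv> (\<lambda>\<epsilon>. rel_belief f (perturbed_cond \<epsilon> K Q) P\<Psi> x)"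
  shows "((\<lambda>\<epsilon>. (RB\<epsilon> \<epsilon> \<psi>0 - RB \<psi>0) / \<epsilon>) \<longlongrightarrow> mQ / m * (RBQ \<psi>0 - RB \<psi>0)) (at_right 0) \<and>
    ((\<lambda>\<epsilon>. ((1 - perturbed_weight m mQ \<epsilon>) * RB \<psi>0 + perturbed_weight m mQ \<epsilon> * RBQ \<psi>0 - RB \<psi>0) / \<epsilon>)
      \<longlongrightarrow> mQ / m * (RBQ \<psi>0 - RB \<psi>0)) (at 0)"
proof -
  interpret rb_model \<mu> f \<nu> P p \<Psi> \<nu>\<Psi> P\<Psi> p\<Psi> \<nu>fib K k by (rule model)
  have sets: "sets P\<Psi> = sets \<nu>\<Psi>" by (simp add: marginal)
  have K: "K \<in> measurable P\<Psi> (prob_algebra \<nu>)" and Q: "Q \<in> measurable P\<Psi> (prob_algebra \<nu>)"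
    using cond_kernel Q_kernel by (simp_all add: measurable_cong_sets[OF sets refl])
  have \<psi>: "\<psi>0 \<in> space P\<Psi>" using \<psi>0 sets_eq_imp_space_eq[OF sets] by simp
  have mK: "integrable (P\<Psi> \<bind> K) (\<lambda>\<theta>. f \<theta> x)"
    using m_finite(1) by (simp add: disintegration[symmetric])
  let ?w = "perturbed_weight m mQ"
  have RB\<epsilon>: "RB\<epsilon> \<epsilon> \<psi>0 = (1 - ?w \<epsilon>) * RB \<psi>0 + ?w \<epsilon> * RBQ \<psi>0" if "0 \<le> \<epsilon>" "\<epsilon> \<le> 1" for \<epsilon>
    unfolding RB\<epsilon>_def RB_def RBQ_def m_def mQ_def
    by (rule rel_belief_perturbed[where f=f and x=x, OF K Q that \<psi> likelihood_measurable[OF x] mK mQ_finite(1)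
          m_finite(2) mQ_finite(2) m_pos mQ_pos])
  have lim: "((\<lambda>\<epsilon>. ((1 - ?w \<epsilon>) * RB \<psi>0 + ?w \<epsilon> * RBQ \<psi>0 - RB \<psi>0) / \<epsilon>)
      \<longlongrightarrow> mQ / m * (RBQ \<psi>0 - RB \<psi>0)) (at 0)"
    using m_pos by (intro tendsto_weight_quotient) (simp add: m_def)
  have "\<forall>\<^sub>F \<epsilon> in at_right 0. ((1 - ?w \<epsilon>) * RB \<psi>0 + ?w \<epsilon> * RBQ \<psi>0 - RB \<psi>0) / \<epsilon>
      = (RB\<epsilon> \<epsilon> \<psi>0 - RB \<psi>0) / \<epsilon>"
    using eventually_at_right_real[of 0 1] by (auto elim!: eventually_mono simp: RB\<epsilon>)
  then have "((\<lambda>\<epsilon>. (RB\<epsilon> \<epsilon> \<psi>0 - RB \<psi>0) / \<epsilon>) \<longlongrightarrow> mQ / m * (RBQ \<psi>0 - RB \<psi>0)) (at_right 0)"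
    by (rule Lim_transform_eventually[OF tendsto_within_subset[OF lim subset_UNIV]])
  with lim show ?thesis by blast
qed

end
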